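(* (Gauss' equation) Let $(C_{\mathcal{A}},h,\nabla)$ and $(C_{\mathcal{A}'},h',\nabla')$ be pseudo-Riemannian calculi, with $C_{\mathcal{A}}=(\mathcal{A},\mathfrak{g},M,\varphi)$ and $C_{\mathcal{A}'}=(\mathcal{A}',\mathfrak{g}',M',\varphi')$, and let $(\phi,\psi,\widehat{\psi}):(C_{\mathcal{A}},h)\to(C_{\mathcal{A}'},h')$ be an isometric embedding with second fundamental form $\alpha(\delta,m)=\Pi(\nabla_{\psi(\delta)}m)$ for $\delta\in\mathfrak{g}'$, $m\in M_\Psi$, where $\Pi:M\to M_\Psi^\perp$ is the projection with respect to $M=M_\Psi\oplus M_\Psi^\perp$. Let $R$ and $R'$ be the curvatures of $\nabla$ and $\nabla'$. Let $\delta_i\in\mathfrak{g}'$, $\partial_i=\psi(\delta_i)\in\mathfrak{g}$, $E_i=\Psi(\delta_i)\in M_\Psi$ and $E_i'=\varphi'(\delta_i)\in M'$ for $i=1,2,3,4$. Then $$\phi\big(h(E_1,R(\partial_3,\partial_4)E_2)\big)=h'\big(E_1',R'(\delta_3,\delta_4)E_2'\big)+\phi\big(h(\alpha(\delta_4,E_1),\alpha(\delta_3,E_2))\big)-\phi\big(h(\alpha(\delta_3,E_1),\alpha(\delta_4,E_2))\big).$$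
   Context: Algebras are over $\mathbb{C}$. A real calculus is a tuple $C_{\mathcal{A}}=(\mathcal{A},\mathfrak{g},M,\varphi)$ where $\mathcal{A}$ is a unital $\ast$-algebra, $\mathfrak{g}\subseteq \mathrm{Der}(\mathcal{A})$ is a finite-dimensional real Lie algebra of derivations, $M$ is a right $\mathcal{A}$-module, and $\varphi:\mathfrak{g}\to M$ is an $\mathbb{R}$-linear map whose image generates $M$ as an $\mathcal{A}$-module. A metric on $M$ is a map $h:M\times M\to\mathcal{A}$, additive in the second argument, with $h(m_1,m_2a)=h(m_1,m_2)a$, $h(m_1,m_2)=h(m_2,m_1)^*$, and non-degenerate: $h(m_1,m_2)=0$ for all $m_2$ implies $m_1=0$. A real metric calculus $(C_{\mathcal{A}},h)$ is a real calculus with a metric $h$ on $M$ such that $h(\varphi(\partial_1),\varphi(\partial_2))^*=h(\varphi(\partial_1),\varphi(\partial_2))$ for all $\partial_1,\partial_2\in\mathfrak{g}$. An affine connection on $(M,\mathfrak{g})$ is a map $\nabla:\mathfrak{g}\times M\to M$, $(\partial,m)\mapsto\nabla_\partial m$, additive in $m$, $\mathbb{R}$-linear in $\partial$, with $\nabla_\partial(ma)=(\nabla_\partial m)a+m\,\partial(a)$. Its curvature is $R(\partial_1,\partial_2)m=\nabla_{\partial_1}\nabla_{\partial_2}m-\nabla_{\partial_2}\nabla_{\partial_1}m-\nabla_{[\partial_1,\partial_2]}m$. $(C_{\mathcal{A}},h,\nabla)$ is a pseudo-Riemannian calculus if for all $\partial,\partial_1,\partial_2\in\mathfrak{g}$,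 $m,n\in M$: $h(\nabla_\partial\varphi(\partial_1),\varphi(\partial_2))$ is hermitian (equal to its own $\ast$); $\partial(h(m,n))=h(\nabla_\partial m,n)+h(m,\nabla_\partial n)$; and $\nabla_{\partial_1}\varphi(\partial_2)-\nabla_{\partial_2}\varphi(\partial_1)-\varphi([\partial_1,\partial_2])=0$. A real calculus homomorphism $(\phi,\psi,\widehat{\psi}):C_{\mathcal{A}}\to C_{\mathcal{A}'}$ consists of: a $\ast$-algebra homomorphism $\phi:\mathcal{A}\to\mathcal{A}'$; a Lie algebra homomorphism $\psi:\mathfrak{g}'\to\mathfrak{g}$ with $\delta(\phi(a))=\phi(\psi(\delta)(a))$ for all $\delta\in\mathfrak{g}'$, $a\in\mathcal{A}$; and, setting $\Psi=\varphi\circ\psi$ and letting $M_\Psi$ be the submodule of $M$ generated by $\Psi(\mathfrak{g}')$, a map $\widehat{\psi}:M_\Psi\to M'$ that is additive, satisfies $\widehat{\psi}(ma)=\widehat{\psi}(m)\phi(a)$ for $m\in M_\Psi$, $a\in\mathcal{A}$, and $\widehat{\psi}(\Psi(\delta))=\varphi'(\delta)$ for all $\delta\in\mathfrak{g}'$. It is an isometric embedding $(C_{\mathcal{A}},h)\to(C_{\mathcal{A}'},h')$ of real metric calculi if $h'(\varphi'(\delta_1),\varphi'(\delta_2))=\phi(h(\Psi(\delta_1),\Psi(\delta_2)))$ for all $\delta_1,\delta_2\in\mathfrak{g}'$, $\phi$ is surjective, and $M=M_\Psi\oplus M_\Psi^\perp$, where $M_\Psi^\perp=\{m\in M: h(m,n)=0\text{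 for all }n\in M_\Psi\}$. *)

theory Defs
  imports Complex_Main "HOL-Library.Function_Algebras"
begin

(* Unital *-algebras over the complex numbers.  The class is built on monoid_mult rather than
   ring_1, so that 1 = 0 (the zero algebra) is not excluded.  The real scaling inherited from
   real_algebra is tied to the complex one. *)
class complex_star_algebra = real_algebra + monoid_mult +
  fixes scaleC :: "complex \<Rightarrow> 'a \<Rightarrow> 'a"  (infixr \<open>*\<^sub>C\<close> 75)
    and star :: "'a \<Rightarrow> 'a"
  assumes scaleR_scaleC: "r *\<^sub>R a = complex_of_real r *\<^sub>C a"
    and scaleC_add_right: "c *\<^sub>C (a + b) = c *\<^sub>C a + c *\<^sub>C b"
    and scaleC_add_left: "(c + d) *\<^sub>C a = c *\<^sub>C a + d *\<^sub>C a"
    and scaleC_scaleC: "c *\<^sub>C (d *\<^sub>C a) = (c * d) *\<^sub>C a"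
    and scaleC_one: "1 *\<^sub>C a = a"
    and mult_scaleC_left: "(c *\<^sub>C a) * b = c *\<^sub>C (a * b)"
    and mult_scaleC_right: "a * (c *\<^sub>C b) = c *\<^sub>C (a * b)"
    and star_star: "star (star a) = a"
    and star_add: "star (a + b) = star a + star b"
    and star_scaleC: "star (c *\<^sub>C a) = cnj c *\<^sub>C star a"
    and star_mult: "star (a * b) = star b * star a"

(* Pointwise real vector space structure on functions, so that a real Lie algebra of derivations
   can be a "subspace" of 'a => 'a in the sense of the library. *)
instantiation "fun" :: (type, real_vector) real_vector
begin

definition "scaleR r f = (\<lambda>x. r *\<^sub>R f x)"

instance
  by standard (simp_all add: scaleR_fun_def fun_eq_iff scaleR_add_right scaleR_add_left)

end

definition derivation :: "('a::complex_star_algebra \<Rightarrow> 'a) \<Rightarrow> bool" where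
  "derivation D \<longleftrightarrow>
     (\<forall>a b. D (a + b) = D a + D b) \<and>
     (\<forall>c a. D (c *\<^sub>C a) = c *\<^sub>C D a) \<and>
     (\<forall>a b. D (a * b) = D a * b + a * D b)"

definition lie_bracket :: "('a::ab_group_add \<Rightarrow> 'a) \<Rightarrow> ('a \<Rightarrow> 'a) \<Rightarrow> ('a \<Rightarrow> 'a)" where
  "lie_bracket D1 D2 = D1 \<circ> D2 - D2 \<circ> D1"

definition fin_dim_lie_algebra_of_derivations :: "('a::complex_star_algebra \<Rightarrow> 'a) set \<Rightarrow> bool" where
  "fin_dim_lie_algebra_of_derivations \<gg> \<longleftrightarrow>
     (\<forall>D\<in>\<gg>. derivation D) \<and>
     subspace \<gg> \<and>
     (\<exists>B. finite B \<and> \<gg> = span B) \<and>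
     (\<forall>D1\<in>\<gg>. \<forall>D2\<in>\<gg>. lie_bracket D1 D2 \<in> \<gg>)"

(* A right module over a *-algebra; act m a stands for the product m a.  The action of scalars
   on the module is the one induced by the unit of the algebra: m times r is act m (r 1). *)
locale right_module =
  fixes act :: "'m::ab_group_add \<Rightarrow> 'a::complex_star_algebra \<Rightarrow> 'm"
  assumes act_add_left: "act (m + n) a = act m a + act n a"
    and act_add_right: "act m (a + b) = act m a + act m b"
    and act_mult: "act m (a * b) = act (act m a) b"
    and act_one: "act m 1 = m"

definition right_submodule :: "('m::ab_group_add \<Rightarrow> 'a \<Rightarrow> 'm) \<Rightarrow> 'm set \<Rightarrow> bool" where
  "right_submodule act N \<longleftrightarrow>
     0 \<in> N \<and> (\<forall>m\<in>N. \<forall>n\<in>N. m + n \<in> N) \<and> (\<forall>m\<in>N. \<forall>a. act m a \<in> N)"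

(* Maps with domain \<gg> (such as vphi) or with domain a submodule (such as psi_hat below) are total
   functions of which only the values on that domain are constrained or used. *)
locale real_calculus = right_module act
  for act :: "'m::ab_group_add \<Rightarrow> 'a::complex_star_algebra \<Rightarrow> 'm" +
  fixes \<gg> :: "('a \<Rightarrow> 'a) set"
    and vphi :: "('a \<Rightarrow> 'a) \<Rightarrow> 'm"
  assumes lie_algebra: "fin_dim_lie_algebra_of_derivations \<gg>"
    and vphi_add: "\<lbrakk>D1 \<in> \<gg>; D2 \<in> \<gg>\<rbrakk> \<Longrightarrow> vphi (D1 + D2) = vphi D1 + vphi D2"
    and vphi_scaleR: "D \<in> \<gg> \<Longrightarrow> vphi (r *\<^sub>R D) = act (vphi D) (r *\<^sub>R 1)"
    and vphi_generates: "right_submodule act hull (vphi ` \<gg>) = UNIV"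

locale module_metric =
  fixes act :: "'m::ab_group_add \<Rightarrow> 'a::complex_star_algebra \<Rightarrow> 'm"
    and h :: "'m \<Rightarrow> 'm \<Rightarrow> 'a"
  assumes h_add: "h m (n1 + n2) = h m n1 + h m n2"
    and h_act: "h m (act n a) = h m n * a"
    and h_star: "h m n = star (h n m)"
    and h_nondegenerate: "(\<And>n. h m n = 0) \<Longrightarrow> m = 0"

locale real_metric_calculus = real_calculus act \<gg> vphi + module_metric act h
  for act :: "'m::ab_group_add \<Rightarrow> 'a::complex_star_algebra \<Rightarrow> 'm" and \<gg> vphi h +
  assumes h_vphi_hermitian:
    "\<lbrakk>D1 \<in> \<gg>; D2 \<in> \<gg>\<rbrakk> \<Longrightarrow> star (h (vphi D1) (vphi D2)) = h (vphi D1) (vphi D2)"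

locale affine_connection =
  fixes act :: "'m::ab_group_add \<Rightarrow> 'a::complex_star_algebra \<Rightarrow> 'm"
    and \<gg> :: "('a \<Rightarrow> 'a) set"
    and nabla :: "('a \<Rightarrow> 'a) \<Rightarrow> 'm \<Rightarrow> 'm"
  assumes nabla_add: "D \<in> \<gg> \<Longrightarrow> nabla D (m + n) = nabla D m + nabla D n"
    and nabla_add_derivation:
      "\<lbrakk>D1 \<in> \<gg>; D2 \<in> \<gg>\<rbrakk> \<Longrightarrow> nabla (D1 + D2) m = nabla D1 m + nabla D2 m"
    and nabla_scaleR_derivation:
      "D \<in> \<gg> \<Longrightarrow> nabla (r *\<^sub>R D) m = act (nabla D m) (r *\<^sub>R 1)"
    and nabla_act: "D \<in> \<gg> \<Longrightarrow> nabla D (act m a) = act (nabla D m) a + act m (D a)"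

definition curvature ::
    "(('a::ab_group_add \<Rightarrow> 'a) \<Rightarrow> 'm::ab_group_add \<Rightarrow> 'm) \<Rightarrow> ('a \<Rightarrow> 'a) \<Rightarrow> ('a \<Rightarrow> 'a) \<Rightarrow> 'm \<Rightarrow> 'm" where
  "curvature nabla D1 D2 m =
     nabla D1 (nabla D2 m) - nabla D2 (nabla D1 m) - nabla (lie_bracket D1 D2) m"

locale pseudo_riemannian_calculus =
    real_metric_calculus act \<gg> vphi h + affine_connection act \<gg> nabla
  for act :: "'m::ab_group_add \<Rightarrow> 'a::complex_star_algebra \<Rightarrow> 'm" and \<gg> vphi h nabla +
  assumes nabla_hermitian:
      "\<lbrakk>D \<in> \<gg>; D1 \<in> \<gg>; D2 \<in> \<gg>\<rbrakk> \<Longrightarrow>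
         star (h (nabla D (vphi D1)) (vphi D2)) = h (nabla D (vphi D1)) (vphi D2)"
    and nabla_metric: "D \<in> \<gg> \<Longrightarrow> D (h m n) = h (nabla D m) n + h m (nabla D n)"
    and nabla_torsion_free:
      "\<lbrakk>D1 \<in> \<gg>; D2 \<in> \<gg>\<rbrakk> \<Longrightarrow>
         nabla D1 (vphi D2) - nabla D2 (vphi D1) - vphi (lie_bracket D1 D2) = 0"

definition star_algebra_hom ::
    "('a::complex_star_algebra \<Rightarrow> 'b::complex_star_algebra) \<Rightarrow> bool" where
  "star_algebra_hom \<phi> \<longleftrightarrow>
     (\<forall>a b. \<phi> (a + b) = \<phi> a + \<phi> b) \<and>
     (\<forall>c a. \<phi> (c *\<^sub>C a) = c *\<^sub>C \<phi> a) \<and>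
     (\<forall>a b. \<phi> (a * b) = \<phi> a * \<phi> b) \<and>
     \<phi> 1 = 1 \<and>
     (\<forall>a. \<phi> (star a) = star (\<phi> a))"

definition lie_algebra_hom ::
    "('b::real_vector \<Rightarrow> 'b) set \<Rightarrow> ('a::real_vector \<Rightarrow> 'a) set \<Rightarrow> (('b \<Rightarrow> 'b) \<Rightarrow> ('a \<Rightarrow> 'a)) \<Rightarrow> bool" where
  "lie_algebra_hom \<gg>' \<gg> \<psi> \<longleftrightarrow>
     \<psi> ` \<gg>' \<subseteq> \<gg> \<and>
     (\<forall>\<delta>1\<in>\<gg>'. \<forall>\<delta>2\<in>\<gg>'. \<psi> (\<delta>1 + \<delta>2) = \<psi> \<delta>1 + \<psi> \<delta>2) \<and>
     (\<forall>r. \<forall>\<delta>\<in>\<gg>'. \<psi> (r *\<^sub>R \<delta>) = r *\<^sub>R \<psi> \<delta>) \<and>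
     (\<forall>\<delta>1\<in>\<gg>'. \<forall>\<delta>2\<in>\<gg>'. \<psi> (lie_bracket \<delta>1 \<delta>2) = lie_bracket (\<psi> \<delta>1) (\<psi> \<delta>2))"

(* The submodule M_Psi of M generated by Psi(\<gg>'), where Psi = vphi o psi. *)
definition M_Psi ::
    "('m::ab_group_add \<Rightarrow> 'a \<Rightarrow> 'm) \<Rightarrow> (('a \<Rightarrow> 'a) \<Rightarrow> 'm) \<Rightarrow>
     ('b \<Rightarrow> 'b) set \<Rightarrow> (('b \<Rightarrow> 'b) \<Rightarrow> ('a \<Rightarrow> 'a)) \<Rightarrow> 'm set" where
  "M_Psi act vphi \<gg>' \<psi> = right_submodule act hull ((vphi \<circ> \<psi>) ` \<gg>')"

locale real_calculus_hom =
    C: real_calculus act \<gg> vphi + C': real_calculus act' \<gg>' vphi'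
  for act :: "'m::ab_group_add \<Rightarrow> 'a::complex_star_algebra \<Rightarrow> 'm" and \<gg> vphi
    and act' :: "'n::ab_group_add \<Rightarrow> 'b::complex_star_algebra \<Rightarrow> 'n" and \<gg>' vphi' +
  fixes \<phi> :: "'a \<Rightarrow> 'b"
    and \<psi> :: "('b \<Rightarrow> 'b) \<Rightarrow> ('a \<Rightarrow> 'a)"
    and psi_hat :: "'m \<Rightarrow> 'n"
  assumes phi_hom: "star_algebra_hom \<phi>"
    and psi_hom: "lie_algebra_hom \<gg>' \<gg> \<psi>"
    and phi_psi: "\<delta> \<in> \<gg>' \<Longrightarrow> \<delta> (\<phi> a) = \<phi> (\<psi> \<delta> a)"
    and psi_hat_add:
      "\<lbrakk>m1 \<in> M_Psi act vphi \<gg>' \<psi>; m2 \<in> M_Psi act vphi \<gg>' \<psi>\<rbrakk> \<Longrightarrow>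
         psi_hat (m1 + m2) = psi_hat m1 + psi_hat m2"
    and psi_hat_act:
      "m \<in> M_Psi act vphi \<gg>' \<psi> \<Longrightarrow> psi_hat (act m a) = act' (psi_hat m) (\<phi> a)"
    and psi_hat_Psi: "\<delta> \<in> \<gg>' \<Longrightarrow> psi_hat ((vphi \<circ> \<psi>) \<delta>) = vphi' \<delta>"

definition orth_complement :: "('m \<Rightarrow> 'm \<Rightarrow> 'a::zero) \<Rightarrow> 'm set \<Rightarrow> 'm set" where
  "orth_complement h N = {m. \<forall>n\<in>N. h m n = 0}"

definition is_direct_sum :: "'m::ab_group_add set \<Rightarrow> 'm set \<Rightarrow> bool" where
  "is_direct_sum U V \<longleftrightarrow> (\<forall>m. \<exists>u\<in>U. \<exists>v\<in>V. m = u + v) \<and> U \<inter> V = {0}"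

(* The V-component of m with respect to a decomposition of the whole module as the direct sum
   of U and V; only meaningful if is_direct_sum U V. *)
definition direct_sum_proj :: "'m::ab_group_add set \<Rightarrow> 'm set \<Rightarrow> 'm \<Rightarrow> 'm" where
  "direct_sum_proj U V m = (THE v. v \<in> V \<and> (\<exists>u\<in>U. m = u + v))"

locale isometric_embedding =
    real_calculus_hom act \<gg> vphi act' \<gg>' vphi' \<phi> \<psi> psi_hat +
    C: real_metric_calculus act \<gg> vphi h + C': real_metric_calculus act' \<gg>' vphi' h'
  for act :: "'m::ab_group_add \<Rightarrow> 'a::complex_star_algebra \<Rightarrow> 'm" and \<gg> vphi h
    and act' :: "'n::ab_group_add \<Rightarrow> 'b::complex_star_algebra \<Rightarrow> 'n" and \<gg>' vphi' h'
    and \<phi> \<psi> psi_hat +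
  assumes isometric:
      "\<lbrakk>\<delta>1 \<in> \<gg>'; \<delta>2 \<in> \<gg>'\<rbrakk> \<Longrightarrow>
         h' (vphi' \<delta>1) (vphi' \<delta>2) = \<phi> (h ((vphi \<circ> \<psi>) \<delta>1) ((vphi \<circ> \<psi>) \<delta>2))"
    and phi_surj: "surj \<phi>"
    and orthogonal_decomposition:
      "is_direct_sum (M_Psi act vphi \<gg>' \<psi>) (orth_complement h (M_Psi act vphi \<gg>' \<psi>))"

definition second_fundamental_form ::
    "('m::ab_group_add \<Rightarrow> 'a \<Rightarrow> 'm) \<Rightarrow> (('a \<Rightarrow> 'a) \<Rightarrow> 'm) \<Rightarrow> ('m \<Rightarrow> 'm \<Rightarrow> 'a::zero) \<Rightarrow>
     (('a \<Rightarrow> 'a) \<Rightarrow> 'm \<Rightarrow> 'm) \<Rightarrow> ('b \<Rightarrow> 'b) set \<Rightarrow> (('b \<Rightarrow> 'b) \<Rightarrow> ('a \<Rightarrow> 'a)) \<Rightarrow>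
     ('b \<Rightarrow> 'b) \<Rightarrow> 'm \<Rightarrow> 'm" where
  "second_fundamental_form act vphi h nabla \<gg>' \<psi> \<delta> m =
     direct_sum_proj (M_Psi act vphi \<gg>' \<psi>) (orth_complement h (M_Psi act vphi \<gg>' \<psi>))
       (nabla (\<psi> \<delta>) m)"

end

theory Submission
  imports Defs
begin

text \<open>
  The difference between \<open>\<phi> (h (\<nabla>\<^sub>i E\<^sub>j) E\<^sub>k)\<close> and \<open>h' (\<nabla>'\<^sub>i E'\<^sub>j) E'\<^sub>k\<close> is symmetric in \<open>i, j\<close>,
  because both connections are torsion free, and antisymmetric in \<open>j, k\<close>, because both are metric
  and hermitian; hence it vanishes.  The Leibniz rules extend this from the generators to the whole
  of \<open>M\<^sub>\<Psi>\<close>, so that \<open>psi_hat\<close> carries the tangential part of \<open>\<nabla>\<close> to \<open>\<nabla>'\<close>.  Splitting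
  \<open>\<nabla>\<^sub>4 E\<^sub>2\<close> into its tangential part and its normal part \<open>\<alpha> \<delta>\<^sub>4 E\<^sub>2\<close>, the former yields the second
  derivatives in \<open>R'\<close>, and differentiating \<open>h E\<^sub>1 (\<alpha> \<delta>\<^sub>4 E\<^sub>2) = 0\<close> along \<open>\<psi> \<delta>\<^sub>3\<close> turns the
  latter into the terms in \<open>\<alpha>\<close>.
\<close>

text \<open>Alternating the two swaps six times returns to the original order of indices, and three
  of the six change the sign. Real scalars then allow cancelling the factor 2.\<close>

lemma eq_zero_if_symmetric_antisymmetric:
  fixes X :: "'i \<Rightarrow> 'i \<Rightarrow> 'i \<Rightarrow> 'v::real_vector"
  assumes "i \<in> I" "j \<in> I" "k \<in> I"
    and sym: "\<And>i j k. \<lbrakk>i \<in> I; j \<in> I; k \<in> I\<rbrakk> \<Longrightarrow> X i j k = X j i k"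
    and antisym: "\<And>i j k. \<lbrakk>i \<in> I; j \<in> I; k \<in> I\<rbrakk> \<Longrightarrow> X i j k = - X i k j"
  shows "X i j k = 0"
proof -
  have "X i j k = X j i k" using assms by blast
  also have "\<dots> = - X j k i" using assms by blast
  also have "\<dots> = - X k j i" using sym[of j k i] assms(1-3) by simp
  also have "\<dots> = X k i j" using antisym[of k j i] assms(1-3) by simp
  also have "\<dots> = X i k j" using assms by blast
  also have "\<dots> = - X i j k" using assms by blast
  finally have "2 *\<^sub>R X i j k = 0" by (simp only: scaleR_2 eq_neg_iff_add_eq_0)
  then show ?thesis by simp
qed

section \<open>Generated submodules and direct sums\<close>

lemma right_submodule_hull: "right_submodule act (right_submodule act hull S)"
  by (rule hull_in) (auto simp: right_submodule_def)

text \<open>Membership in the hull is carried through the induction, because the laws for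
  \<open>psi_hat\<close> hold only on the generated submodule.\<close>

lemma right_submodule_hull_induct [consumes 1, case_names base zero add act]:
  assumes "m \<in> right_submodule act hull S"
    and "\<And>m. m \<in> S \<Longrightarrow> P m"
    and "P 0"
    and "\<And>m n. \<lbrakk>m \<in> right_submodule act hull S; n \<in> right_submodule act hull S; P m; P n\<rbrakk>
           \<Longrightarrow> P (m + n)"
    and "\<And>m a. \<lbrakk>m \<in> right_submodule act hull S; P m\<rbrakk> \<Longrightarrow> P (act m a)"
  shows "P m"
proof -
  have "m \<in> right_submodule act hull S \<and> P m"
    using assms(1)
  proof (rule hull_induct)
    show "right_submodule act {m. m \<in> right_submodule act hull S \<and> P m}"
      using assms(3-5) right_submodule_hull[of act S] by (auto simp: right_submodule_def)
  qed (use assms(2) in \<open>auto intro: hull_inc\<close>)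
  then show ?thesis ..
qed

lemma star_zero [simp]: "star (0::'a::complex_star_algebra) = 0"
  using star_add[of "0::'a" 0] by simp

lemma star_algebra_hom_zero: "star_algebra_hom \<phi> \<Longrightarrow> \<phi> 0 = 0"
  unfolding star_algebra_hom_def by (metis add_cancel_right_left)

lemma star_algebra_hom_diff: "star_algebra_hom \<phi> \<Longrightarrow> \<phi> (a - b) = \<phi> a - \<phi> b"
  unfolding star_algebra_hom_def by (metis add_diff_cancel_right' diff_add_cancel)

lemma direct_sum_projE:
  assumes "is_direct_sum U V" "right_submodule act U" "right_submodule act V"
    and "right_module act"
  obtains u where "u \<in> U" "direct_sum_proj U V m \<in> V" "m = u + direct_sum_proj U V m"
proof -
  interpret right_module act by fact
  \<comment> \<open>\<open>right_submodule\<close> does not list closure under negation; acting by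
    -1 supplies it, and hence closure under differences.\<close>
  have act_minus: "act n (- 1) = - n" for n
    using act_add_right[of n 1 "- 1"] act_add_right[of n 0 0] act_one[of n]
    by (simp add: eq_neg_iff_add_eq_0 add.commute)
  have diff: "m - n \<in> N" if "right_submodule act N" "m \<in> N" "n \<in> N" for N m n
    using that act_minus[of n] unfolding right_submodule_def
    by (metis add_uminus_conv_diff)
  have "\<exists>!v. v \<in> V \<and> (\<exists>u\<in>U. m = u + v)"
  proof (rule ex_ex1I)
    show "\<exists>v. v \<in> V \<and> (\<exists>u\<in>U. m = u + v)"
      using assms(1) unfolding is_direct_sum_def by blast
  next
    fix v w
    assume "v \<in> V \<and> (\<exists>u\<in>U. m = u + v)" "w \<in> V \<and> (\<exists>u\<in>U. m = u + w)"
    then obtain u u' where u: "u \<in> U" "u' \<in> U" "v \<in> V" "w \<in> V" "m = u + v" "m = u' + w"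
      by blast
    \<comment> \<open>The difference of two candidate components lies in both summands, which meet
      only in 0.\<close>
    then have "v - w = u' - u" by (simp add: algebra_simps)
    with u have "v - w \<in> U \<inter> V" using diff assms(2,3) by fastforce
    then have "v - w = 0" using assms(1) unfolding is_direct_sum_def by blast
    then show "v = w" by simp
  qed
  from theI'[OF this] that show ?thesis unfolding direct_sum_proj_def by blast
qed

section \<open>Metrics and connections on a single module\<close>

context module_metric
begin

lemma h_add_left: "h (m1 + m2) n = h m1 n + h m2 n"
  by (metis h_add h_star star_add)

lemma h_act_left: "h (act m a) n = star a * h m n"
  by (metis h_act h_star star_mult)

lemma h_zero_right [simp]: "h m 0 = 0"
  using h_add[of m 0 0] by simp

lemma h_zero_left [simp]: "h 0 m = 0"
  using h_add_left[of 0 0] by simp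

lemma h_diff: "h m (n1 - n2) = h m n1 - h m n2"
  using h_add[of m "n1 - n2" n2] by (simp add: algebra_simps)

lemma h_diff_left: "h (m1 - m2) n = h m1 n - h m2 n"
  using h_add_left[of "m1 - m2" m2 n] by (simp add: algebra_simps)

lemma h_eq_zero_commute: "h m n = 0 \<Longrightarrow> h n m = 0"
  by (metis h_star star_zero)

lemma h_nondegenerate_right: "(\<And>m. h m n1 = h m n2) \<Longrightarrow> n1 = n2"
  using h_nondegenerate[of "n1 - n2"] h_eq_zero_commute by (metis h_diff eq_iff_diff_eq_0)

lemma right_submodule_orth_complement:
  "right_submodule act (orth_complement h N)"
  by (auto simp: right_submodule_def orth_complement_def h_add_left h_act_left)

end

lemma (in affine_connection) nabla_zero: "D \<in> \<gg> \<Longrightarrow> nabla D 0 = 0"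
  using nabla_add[of D 0 0] by simp

lemma (in pseudo_riemannian_calculus) nabla_hermitian_right:
  "\<lbrakk>D \<in> \<gg>; D1 \<in> \<gg>; D2 \<in> \<gg>\<rbrakk> \<Longrightarrow> h (vphi D2) (nabla D (vphi D1)) = h (nabla D (vphi D1)) (vphi D2)"
  by (metis h_star nabla_hermitian)

lemma (in pseudo_riemannian_calculus) derivation_zero: "D \<in> \<gg> \<Longrightarrow> D 0 = 0"
  using nabla_metric[of D 0 0] nabla_zero[of D] by simp

text \<open>No assumption is added to the two calculi and the embedding, so the hypotheses of the
  final theorem suffice to interpret it.\<close>

locale pseudo_riemannian_embedding =
    isometric_embedding act \<gg> vphi h act' \<gg>' vphi' h' \<phi> \<psi> psi_hat +
    C: pseudo_riemannian_calculus act \<gg> vphi h nabla +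
    C': pseudo_riemannian_calculus act' \<gg>' vphi' h' nabla'
  for act :: "'m::ab_group_add \<Rightarrow> 'a::complex_star_algebra \<Rightarrow> 'm" and \<gg> vphi h
    and act' :: "'n::ab_group_add \<Rightarrow> 'b::complex_star_algebra \<Rightarrow> 'n" and \<gg>' vphi' h'
    and \<phi> \<psi> psi_hat nabla nabla'
begin

abbreviation M\<^sub>\<Psi> where "M\<^sub>\<Psi> \<equiv> M_Psi act vphi \<gg>' \<psi>"
abbreviation \<alpha> where "\<alpha> \<equiv> second_fundamental_form act vphi h nabla \<gg>' \<psi>"

section \<open>The structure maps of the embedding\<close>

lemma phi_simps:
  "\<phi> (a + b) = \<phi> a + \<phi> b" "\<phi> (a * b) = \<phi> a * \<phi> b" "\<phi> (star a) = star (\<phi> a)"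
  "\<phi> 0 = 0" "\<phi> (a - b) = \<phi> a - \<phi> b"
  using phi_hom star_algebra_hom_zero[OF phi_hom] star_algebra_hom_diff[OF phi_hom]
  by (auto simp: star_algebra_hom_def)

lemma psi_in: "\<delta> \<in> \<gg>' \<Longrightarrow> \<psi> \<delta> \<in> \<gg>"
  using psi_hom by (auto simp: lie_algebra_hom_def)

lemma psi_lie_bracket:
  "\<lbrakk>\<delta>1 \<in> \<gg>'; \<delta>2 \<in> \<gg>'\<rbrakk> \<Longrightarrow> \<psi> (lie_bracket \<delta>1 \<delta>2) = lie_bracket (\<psi> \<delta>1) (\<psi> \<delta>2)"
  using psi_hom by (simp add: lie_algebra_hom_def)

lemma lie_bracket_in: "\<lbrakk>\<delta>1 \<in> \<gg>'; \<delta>2 \<in> \<gg>'\<rbrakk> \<Longrightarrow> lie_bracket \<delta>1 \<delta>2 \<in> \<gg>'"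
  using C'.lie_algebra by (simp add: fin_dim_lie_algebra_of_derivations_def)

lemma M_Psi_submodule: "right_submodule act M\<^sub>\<Psi>"
  unfolding M_Psi_def by (rule right_submodule_hull)

lemma Psi_in: "\<delta> \<in> \<gg>' \<Longrightarrow> vphi (\<psi> \<delta>) \<in> M\<^sub>\<Psi>"
  unfolding M_Psi_def by (rule hull_inc) simp

lemma M_Psi_induct [consumes 1, case_names base zero add act]:
  assumes "m \<in> M\<^sub>\<Psi>"
    and "\<And>\<delta>. \<delta> \<in> \<gg>' \<Longrightarrow> P (vphi (\<psi> \<delta>))"
    and "P 0"
    and "\<And>m n. \<lbrakk>m \<in> M\<^sub>\<Psi>; n \<in> M\<^sub>\<Psi>; P m; P n\<rbrakk> \<Longrightarrow> P (m + n)"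
    and "\<And>m a. \<lbrakk>m \<in> M\<^sub>\<Psi>; P m\<rbrakk> \<Longrightarrow> P (act m a)"
  shows "P m"
  using assms unfolding M_Psi_def by (induction rule: right_submodule_hull_induct) auto

section \<open>Transport of the metric and the connection\<close>

lemma psi_hat_vphi: "\<delta> \<in> \<gg>' \<Longrightarrow> psi_hat (vphi (\<psi> \<delta>)) = vphi' \<delta>"
  using psi_hat_Psi by simp

lemma psi_hat_zero: "psi_hat 0 = 0"
  using psi_hat_add[of 0 0] M_Psi_submodule by (simp add: right_submodule_def)

text \<open>Both sides are additive in \<open>n\<close> and turn its action by \<open>a\<close> into
  left multiplication by \<open>\<phi> (star a)\<close>. The element \<open>m\<close> is arbitrary,
  since derivatives of elements of \<open>M\<^sub>\<Psi>\<close> may leave it.\<close>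

lemma phi_h_eqI_generators:
  assumes "\<And>\<delta>. \<delta> \<in> \<gg>' \<Longrightarrow> \<phi> (h (vphi (\<psi> \<delta>)) m) = h' (vphi' \<delta>) m'"
    and "n \<in> M\<^sub>\<Psi>"
  shows "\<phi> (h n m) = h' (psi_hat n) m'"
  using assms(2)
proof (induction rule: M_Psi_induct)
  case (base \<delta>)
  then show ?case using assms(1) by (simp add: psi_hat_vphi)
qed (simp_all add: phi_simps psi_hat_zero psi_hat_add psi_hat_act C.h_add_left C'.h_add_left
       C.h_act_left C'.h_act_left)

lemma phi_h:
  assumes "m \<in> M\<^sub>\<Psi>" "n \<in> M\<^sub>\<Psi>"
  shows "\<phi> (h m n) = h' (psi_hat m) (psi_hat n)"
proof (rule phi_h_eqI_generators[OF _ assms(1)])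
  fix \<delta> assume "\<delta> \<in> \<gg>'"
  with assms(2) show "\<phi> (h (vphi (\<psi> \<delta>)) n) = h' (vphi' \<delta>) (psi_hat n)"
    by (induction rule: M_Psi_induct)
      (use isometric in \<open>simp_all add: phi_simps psi_hat_vphi psi_hat_zero psi_hat_add psi_hat_act
         C.h_add C'.h_add C.h_act C'.h_act\<close>)
qed

text \<open>This replaces a comparison of Koszul formulas: the defect \<open>X\<close> is symmetric
  in one pair of indices and antisymmetric in another.\<close>

lemma phi_h_nabla_generators:
  assumes "i \<in> \<gg>'" "j \<in> \<gg>'" "k \<in> \<gg>'"
  shows "\<phi> (h (nabla (\<psi> i) (vphi (\<psi> j))) (vphi (\<psi> k))) = h' (nabla' i (vphi' j)) (vphi' k)"
proof -
  define X where "X i j k = \<phi> (h (nabla (\<psi> i) (vphi (\<psi> j))) (vphi (\<psi> k)))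
      - h' (nabla' i (vphi' j)) (vphi' k)" for i j k
  have "X i j k = 0"
  proof (rule eq_zero_if_symmetric_antisymmetric[where X = X and I = \<gg>'])
    fix i j k assume ijk: "i \<in> \<gg>'" "j \<in> \<gg>'" "k \<in> \<gg>'"
    note psi = ijk[THEN psi_in]
    \<comment> \<open>Symmetry: both torsion identities reduce the differences to bracket terms, on
      which the two metrics agree by isometry.\<close>
    have "nabla (\<psi> i) (vphi (\<psi> j)) - nabla (\<psi> j) (vphi (\<psi> i)) = vphi (\<psi> (lie_bracket i j))"
      using C.nabla_torsion_free[of "\<psi> i" "\<psi> j"] psi ijk by (simp add: psi_lie_bracket)
    moreover have "nabla' i (vphi' j) - nabla' j (vphi' i) = vphi' (lie_bracket i j)"
      using C'.nabla_torsion_free[of i j] ijk by simp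
    moreover have "\<phi> (h (vphi (\<psi> (lie_bracket i j))) (vphi (\<psi> k))) =
        h' (vphi' (lie_bracket i j)) (vphi' k)"
      using isometric lie_bracket_in ijk by simp
    ultimately have "\<phi> (h (nabla (\<psi> i) (vphi (\<psi> j)) - nabla (\<psi> j) (vphi (\<psi> i))) (vphi (\<psi> k))) =
        h' (nabla' i (vphi' j) - nabla' j (vphi' i)) (vphi' k)"
      by simp
    then show "X i j k = X j i k"
      by (simp add: X_def phi_simps C.h_diff_left C'.h_diff_left algebra_simps)
    \<comment> \<open>Antisymmetry: the isometry identity is differentiated. Metric compatibility
      splits both sides, and hermiticity moves the derivative into the first argument.\<close>
    have "\<phi> (\<psi> i (h (vphi (\<psi> j)) (vphi (\<psi> k)))) = i (h' (vphi' j) (vphi' k))"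
      using phi_psi isometric ijk by simp
    then show "X i j k = - X i k j"
      using ijk psi
      by (simp add: X_def phi_simps C.nabla_metric C'.nabla_metric C.nabla_hermitian_right
          C'.nabla_hermitian_right algebra_simps)
  qed (use assms in simp_all)
  then show ?thesis by (simp add: X_def)
qed

lemma phi_h_nabla:
  assumes "\<delta> \<in> \<gg>'" "m \<in> M\<^sub>\<Psi>" "n \<in> M\<^sub>\<Psi>"
  shows "\<phi> (h n (nabla (\<psi> \<delta>) m)) = h' (psi_hat n) (nabla' \<delta> (psi_hat m))"
  using assms(2)
proof (induction rule: M_Psi_induct)
  case (base \<delta>1)
  show ?case
  proof (rule phi_h_eqI_generators[OF _ assms(3)])
    fix \<delta>2 assume "\<delta>2 \<in> \<gg>'"
    then show "\<phi> (h (vphi (\<psi> \<delta>2)) (nabla (\<psi> \<delta>) (vphi (\<psi> \<delta>1)))) =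
        h' (vphi' \<delta>2) (nabla' \<delta> (psi_hat (vphi (\<psi> \<delta>1))))"
      using phi_h_nabla_generators base assms(1)
      by (simp add: psi_hat_vphi psi_in C.nabla_hermitian_right C'.nabla_hermitian_right)
  qed
next
  case zero
  then show ?case
    using assms(1) by (simp add: psi_in C.nabla_zero C'.nabla_zero phi_simps psi_hat_zero)
next
  case (add m1 m2)
  then show ?case
    using assms(1)
    by (simp add: psi_in C.nabla_add C'.nabla_add C.h_add C'.h_add phi_simps psi_hat_add)
next
  \<comment> \<open>The Leibniz term, in which \<open>a\<close> is differentiated, is matched by
    \<open>phi_h\<close> together with \<open>phi_psi\<close>.\<close>
  case (act m a)
  then show ?case
    using assms(1,3)
    by (simp add: psi_in C.nabla_act C'.nabla_act C.h_add C'.h_add C.h_act C'.h_act phi_simps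
        psi_hat_act phi_h phi_psi)
qed

text \<open>The image of \<open>vphi'\<close> generates the whole target module, where
  \<open>h'\<close> is non-degenerate.\<close>

lemma h'_eqI:
  assumes "\<And>\<delta>. \<delta> \<in> \<gg>' \<Longrightarrow> h' (vphi' \<delta>) m = h' (vphi' \<delta>) n"
  shows "m = n"
proof (rule C'.h_nondegenerate_right)
  fix l
  have "l \<in> right_submodule act' hull (vphi' ` \<gg>')"
    by (simp add: C'.vphi_generates)
  then show "h' l m = h' l n"
    by (induction rule: right_submodule_hull_induct)
      (use assms in \<open>auto simp: C'.h_add_left C'.h_act_left\<close>)
qed

section \<open>The second fundamental form and Gauss' equation\<close>

lemma h_second_fundamental_form:
  assumes "n \<in> M\<^sub>\<Psi>"
  shows "h n (\<alpha> \<delta> m) = 0"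
proof -
  \<comment> \<open>No condition on \<delta> or \<open>m\<close> is required: the direct sum
    decomposes all of the ambient module.\<close>
  have "\<alpha> \<delta> m \<in> orth_complement h M\<^sub>\<Psi>"
    unfolding second_fundamental_form_def
    by (rule direct_sum_projE[OF orthogonal_decomposition M_Psi_submodule
          C.right_submodule_orth_complement C.right_module_axioms])
  then show ?thesis
    using assms C.h_eq_zero_commute by (auto simp: orth_complement_def)
qed

text \<open>Gauss' formula. The normal part vanishes in products with generators of
  \<open>M\<^sub>\<Psi>\<close>, so \<open>phi_h_nabla\<close> determines the image of the
  tangential part \<open>t\<close>.\<close>

lemma nabla_decompose:
  assumes "\<delta> \<in> \<gg>'" "m \<in> M\<^sub>\<Psi>"
  obtains t where "t \<in> M\<^sub>\<Psi>" "nabla (\<psi> \<delta>) m = t + \<alpha> \<delta> m" "psi_hat t = nabla' \<delta> (psi_hat m)"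
proof -
  obtain t where t: "t \<in> M\<^sub>\<Psi>" "nabla (\<psi> \<delta>) m = t + \<alpha> \<delta> m"
    unfolding second_fundamental_form_def
    by (rule direct_sum_projE[OF orthogonal_decomposition M_Psi_submodule
          C.right_submodule_orth_complement C.right_module_axioms])
  have "psi_hat t = nabla' \<delta> (psi_hat m)"
  proof (rule h'_eqI)
    fix \<delta>1 assume \<delta>1: "\<delta>1 \<in> \<gg>'"
    have "\<phi> (h (vphi (\<psi> \<delta>1)) t) = \<phi> (h (vphi (\<psi> \<delta>1)) (nabla (\<psi> \<delta>) m))"
      using \<delta>1 by (simp add: t(2) C.h_add h_second_fundamental_form Psi_in)
    then show "h' (vphi' \<delta>1) (psi_hat t) = h' (vphi' \<delta>1) (nabla' \<delta> (psi_hat m))"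
      using phi_h[of "vphi (\<psi> \<delta>1)" t] phi_h_nabla[of \<delta> m "vphi (\<psi> \<delta>1)"] assms t(1) \<delta>1
      by (simp add: Psi_in psi_hat_vphi)
  qed
  with t that show ?thesis by blast
qed

text \<open>The tangential part of the inner derivative lies in \<open>M\<^sub>\<Psi>\<close> again,
  so \<open>phi_h_nabla\<close> applies a second time; the normal part yields the
  correction.\<close>

lemma phi_h_nabla_nabla:
  assumes "\<delta>1 \<in> \<gg>'" "\<delta>2 \<in> \<gg>'" "m \<in> M\<^sub>\<Psi>" "n \<in> M\<^sub>\<Psi>"
  shows "\<phi> (h n (nabla (\<psi> \<delta>1) (nabla (\<psi> \<delta>2) m))) =
    h' (psi_hat n) (nabla' \<delta>1 (nabla' \<delta>2 (psi_hat m))) - \<phi> (h (\<alpha> \<delta>1 n) (\<alpha> \<delta>2 m))"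
proof -
  obtain t where t: "t \<in> M\<^sub>\<Psi>" "nabla (\<psi> \<delta>2) m = t + \<alpha> \<delta>2 m"
      "psi_hat t = nabla' \<delta>2 (psi_hat m)"
    using nabla_decompose assms by metis
  obtain s where s: "s \<in> M\<^sub>\<Psi>" "nabla (\<psi> \<delta>1) n = s + \<alpha> \<delta>1 n"
    using nabla_decompose assms by metis
  \<comment> \<open>Differentiating this orthogonality trades the derivative of the normal field for
    that of \<open>n\<close>, of which only the normal part survives.\<close>
  have "0 = \<psi> \<delta>1 (h n (\<alpha> \<delta>2 m))"
    using assms by (simp add: h_second_fundamental_form C.derivation_zero psi_in)
  also have "\<dots> = h (nabla (\<psi> \<delta>1) n) (\<alpha> \<delta>2 m) + h n (nabla (\<psi> \<delta>1) (\<alpha> \<delta>2 m))"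
    using assms by (simp only: C.nabla_metric psi_in)
  also have "h (nabla (\<psi> \<delta>1) n) (\<alpha> \<delta>2 m) = h (\<alpha> \<delta>1 n) (\<alpha> \<delta>2 m)"
    using s by (simp add: C.h_add_left h_second_fundamental_form)
  finally have "h n (nabla (\<psi> \<delta>1) (\<alpha> \<delta>2 m)) = - h (\<alpha> \<delta>1 n) (\<alpha> \<delta>2 m)"
    by (simp add: eq_neg_iff_add_eq_0 add.commute)
  then have "h n (nabla (\<psi> \<delta>1) (nabla (\<psi> \<delta>2) m)) =
      h n (nabla (\<psi> \<delta>1) t) - h (\<alpha> \<delta>1 n) (\<alpha> \<delta>2 m)"
    using assms by (simp add: t(2) C.nabla_add psi_in C.h_add)
  then show ?thesis
    using assms t by (simp add: phi_simps phi_h_nabla)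
qed

text \<open>The two orders of differentiation contribute the \<alpha> terms with opposite signs. The
  bracket term contributes none, as it is a single derivative along an element of the image of
  \<psi>.\<close>

theorem gauss_equation:
  assumes "\<delta>1 \<in> \<gg>'" "\<delta>2 \<in> \<gg>'" "m \<in> M\<^sub>\<Psi>" "n \<in> M\<^sub>\<Psi>"
  shows "\<phi> (h n (curvature nabla (\<psi> \<delta>1) (\<psi> \<delta>2) m)) =
    h' (psi_hat n) (curvature nabla' \<delta>1 \<delta>2 (psi_hat m))
    + \<phi> (h (\<alpha> \<delta>2 n) (\<alpha> \<delta>1 m)) - \<phi> (h (\<alpha> \<delta>1 n) (\<alpha> \<delta>2 m))"
  using assms phi_h_nabla[OF lie_bracket_in[OF assms(1,2)] assms(3,4)]
  by (simp add: curvature_def C.h_diff C'.h_diff phi_simps phi_h_nabla_nabla psi_lie_bracket)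

end

theorem proposition4p7:
  fixes act :: "'m::ab_group_add \<Rightarrow> 'a::complex_star_algebra \<Rightarrow> 'm"
    and act' :: "'n::ab_group_add \<Rightarrow> 'b::complex_star_algebra \<Rightarrow> 'n"
    and \<delta>\<^sub>1 \<delta>\<^sub>2 \<delta>\<^sub>3 \<delta>\<^sub>4 :: "'b \<Rightarrow> 'b"
    and \<alpha> :: "('b \<Rightarrow> 'b) \<Rightarrow> 'm \<Rightarrow> 'm"
  assumes "pseudo_riemannian_calculus act \<gg> vphi h nabla"
    and "pseudo_riemannian_calculus act' \<gg>' vphi' h' nabla'"
    and "isometric_embedding act \<gg> vphi h act' \<gg>' vphi' h' \<phi> \<psi> psi_hat"
    and "\<alpha> = second_fundamental_form act vphi h nabla \<gg>' \<psi>"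
    and "\<delta>\<^sub>1 \<in> \<gg>'" and "\<delta>\<^sub>2 \<in> \<gg>'" and "\<delta>\<^sub>3 \<in> \<gg>'" and "\<delta>\<^sub>4 \<in> \<gg>'"
    and "D\<^sub>3 = \<psi> \<delta>\<^sub>3" and "D\<^sub>4 = \<psi> \<delta>\<^sub>4"
    and "E\<^sub>1 = (vphi \<circ> \<psi>) \<delta>\<^sub>1" and "E\<^sub>2 = (vphi \<circ> \<psi>) \<delta>\<^sub>2"
    and "E\<^sub>1' = vphi' \<delta>\<^sub>1" and "E\<^sub>2' = vphi' \<delta>\<^sub>2"
  shows "\<phi> (h E\<^sub>1 (curvature nabla D\<^sub>3 D\<^sub>4 E\<^sub>2)) =
           h' E\<^sub>1' (curvature nabla' \<delta>\<^sub>3 \<delta>\<^sub>4 E\<^sub>2')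
           + \<phi> (h (\<alpha> \<delta>\<^sub>4 E\<^sub>1) (\<alpha> \<delta>\<^sub>3 E\<^sub>2)) - \<phi> (h (\<alpha> \<delta>\<^sub>3 E\<^sub>1) (\<alpha> \<delta>\<^sub>4 E\<^sub>2))"
proof -
  interpret pseudo_riemannian_embedding act \<gg> vphi h act' \<gg>' vphi' h' \<phi> \<psi> psi_hat nabla nabla'
    using assms(1-3) by (simp add: pseudo_riemannian_embedding_def)
  show ?thesis
    using gauss_equation[of \<delta>\<^sub>3 \<delta>\<^sub>4 E\<^sub>2 E\<^sub>1] assms(4-) by (simp add: Psi_in psi_hat_vphi)
qed

end
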